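(* Let $Y=(Y_i)_{i=1}^d$ be a random vector with nonnegative, negatively associated coordinates. Let $T$ be a finite set with $|T|\ge2$, let $m\ge1$ be an integer, let $A_t\subset[d]$ ($t\in T$) satisfy $|A_t|\le m$, and let $b_t\in\mathbb R_+^d$ ($t\in T$) be deterministic vectors with $b_t$ supported on $A_t$. Let $\beta>0$ and assume $$b_t(A_t\setminus A_s)\ge\beta\qquad\text{for all }t\ne s\text{ in }T .$$ Let $\Lambda=\sum_{t\in T}\mathbb P(Y\ge b_t)$ and assume $\Lambda>0$. Let $\varepsilon_1,\dots,\varepsilon_d$ be independent symmetric $\pm1$ signs, independent of $Y$, and set $$M=\mathbb E_{Y,\varepsilon}\max_{t\in T}\left|\sum_{i\in A_t}\varepsilon_iY_i\right|\in[0,\infty],\qquad L_m=2^m\lceil e^{2m}\rceil .$$ Then $$M\ge c_B\,\beta\left(1-\frac{L_m}{\Lambda}\right)_+,$$ where $c_B>0$ is the universal constant of Bernoulli Sudakov minoration specified in the context.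
   Context: $[d]=\{1,\dots,d\}$; $x_+=\max\{x,0\}$; for $v\in\mathbb R_+^d$ and $D\subset[d]$, $v(D)=\sum_{i\in D}v_i$; inequalities between vectors are coordinatewise. $Y$ has negatively associated coordinates if, for all disjoint $I,J\subset[d]$ and all bounded coordinatewise increasing (nondecreasing) functions $f,g$, $\mathbb E f(Y_I)g(Y_J)\le \mathbb E f(Y_I)\,\mathbb E g(Y_J)$, where $Y_I=(Y_i)_{i\in I}$. The constant $c_B$: by Talagrand's Bernoulli Sudakov minoration theorem (known), there is a universal constant $c_B>0$ such that, for every $d$, if $q\ge1$, $b>0$, a finite $V\subset\mathbb R^d$ satisfies $|V|\ge e^q$, and $\left\|\sum_i(v_i-w_i)\varepsilon_i\right\|_q\ge b$ for all $v\ne w$ in $V$ (with $\|\cdot\|_q=(\mathbb E|\cdot|^q)^{1/q}$ and $\varepsilon_i$ independent symmetric signs), then $\mathbb E_\varepsilon\max_{v\in V}\left|\sum_iv_i\varepsilon_i\right|\ge c_B b$. Fix such a $c_B$. *)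

theory Defs
  imports "HOL-Probability.Probability"
begin

text \<open>
  Vectors in \<open>\<real>\<^sup>d\<close> are functions \<open>nat \<Rightarrow> real\<close> of which only the coordinates in \<open>{1..d}\<close> matter.
\<close>

definition sign_pmf :: "nat \<Rightarrow> (nat \<Rightarrow> real) pmf" where
  "sign_pmf d = Pi_pmf {1..d} 0 (\<lambda>_. pmf_of_set {-1, 1})"

definition sign_norm :: "nat \<Rightarrow> real \<Rightarrow> (nat \<Rightarrow> real) \<Rightarrow> real" where
  "sign_norm d q u =
     (measure_pmf.expectation (sign_pmf d) (\<lambda>\<epsilon>. \<bar>\<Sum>i=1..d. u i * \<epsilon> i\<bar> powr q)) powr (1 / q)"

text \<open>
  The constants for which Talagrand's Sudakov minoration for Bernoulli processes holds,
  uniformly in the dimension.  Membership of \<open>V\<close> in \<open>PiE\<close> makes distinct elements of \<open>V\<close>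
  distinct vectors of \<open>\<real>\<^sup>d\<close>.
\<close>

definition bernoulli_sudakov_constant :: "real \<Rightarrow> bool" where
  "bernoulli_sudakov_constant c \<longleftrightarrow>
     c > 0 \<and>
     (\<forall>(d::nat) (q::real) (b::real) (V :: (nat \<Rightarrow> real) set).
        q \<ge> 1 \<longrightarrow> b > 0 \<longrightarrow> finite V \<longrightarrow> V \<subseteq> {1..d} \<rightarrow>\<^sub>E UNIV \<longrightarrow> real (card V) \<ge> exp q \<longrightarrow>
        (\<forall>v\<in>V. \<forall>w\<in>V. v \<noteq> w \<longrightarrow> sign_norm d q (\<lambda>i. v i - w i) \<ge> b) \<longrightarrow>
        measure_pmf.expectation (sign_pmf d) (\<lambda>\<epsilon>. MAX v\<in>V. \<bar>\<Sum>i=1..d. v i * \<epsilon> i\<bar>) \<ge> c * b)"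

definition random_signs :: "'a measure \<Rightarrow> nat set \<Rightarrow> (nat \<Rightarrow> 'a \<Rightarrow> real) \<Rightarrow> bool" where
  "random_signs P I \<epsilon> \<longleftrightarrow>
     prob_space.indep_vars P (\<lambda>_. borel) \<epsilon> I \<and>
     (\<forall>i\<in>I. measure P {\<omega> \<in> space P. \<epsilon> i \<omega> = 1} = 1 / 2 \<and>
            measure P {\<omega> \<in> space P. \<epsilon> i \<omega> = -1} = 1 / 2)"

definition bounded_increasing :: "nat set \<Rightarrow> ((nat \<Rightarrow> real) \<Rightarrow> real) \<Rightarrow> bool" where
  "bounded_increasing I f \<longleftrightarrow>
     (\<exists>C. \<forall>x \<in> I \<rightarrow>\<^sub>E UNIV. \<bar>f x\<bar> \<le> C) \<and>
     (\<forall>x \<in> I \<rightarrow>\<^sub>E UNIV. \<forall>y \<in> I \<rightarrow>\<^sub>E UNIV. (\<forall>i\<in>I. x i \<le> y i) \<longrightarrow> f x \<le> f y)"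

text \<open>
  A coordinatewise increasing function of several variables need not be Borel, so Borel
  measurability of the test functions is required for the expectations to make sense.
\<close>

definition neg_associated :: "'a measure \<Rightarrow> nat \<Rightarrow> (nat \<Rightarrow> 'a \<Rightarrow> real) \<Rightarrow> bool" where
  "neg_associated P d Y \<longleftrightarrow>
     (\<forall>I J f g.
        I \<subseteq> {1..d} \<longrightarrow> J \<subseteq> {1..d} \<longrightarrow> I \<inter> J = {} \<longrightarrow>
        f \<in> borel_measurable (\<Pi>\<^sub>M i\<in>I. borel) \<longrightarrow> bounded_increasing I f \<longrightarrow>
        g \<in> borel_measurable (\<Pi>\<^sub>M i\<in>J. borel) \<longrightarrow> bounded_increasing J g \<longrightarrow>
        (\<integral>\<omega>. f (\<lambda>i\<in>I. Y i \<omega>) * g (\<lambda>i\<in>J. Y i \<omega>) \<partial>P)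
          \<le> (\<integral>\<omega>. f (\<lambda>i\<in>I. Y i \<omega>) \<partial>P) * (\<integral>\<omega>. g (\<lambda>i\<in>J. Y i \<omega>) \<partial>P))"

end

theory Submission imports Defs begin

text \<open>
  For \<open>y\<close> with nonnegative coordinates let \<open>h y\<close> be the mean over random signs of
  \<open>MAX t\<in>T. \<bar>\<Sum>i\<in>A t. \<epsilon> i * y i\<bar>\<close>, and put \<open>K = \<lceil>exp (2 * m)\<rceil>\<close>.  Integrating out the signs first
  gives \<open>M \<ge> E (h Y)\<close>, so by Markov's inequality it suffices to prove
  \<open>P (h Y < c * \<beta>) * \<Lambda> \<le> 2 ^ m * K\<close>.

  Counting the \<open>t\<close> with \<open>Y \<ge> b t\<close> and applying minoration once enough of them occur does not
  work: the sets \<open>A t\<close> may share a coordinate, and then the events \<open>Y \<ge> b t\<close> can all fail together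
  with large probability.  Instead, the event \<open>Y \<ge> b t\<close>, which is increasing in the coordinates in
  \<open>A t\<close>, is paired with the event \<open>D t\<close> that \<open>h\<close> stays below \<open>c * \<beta>\<close> after the coordinates in
  \<open>A t\<close> are set to \<open>0\<close>.  The function \<open>h\<close> is increasing by the contraction principle
  (\<open>mean_sign_max_mono\<close>), so \<open>D t\<close> is decreasing in the remaining coordinates and contains the event
  \<open>h Y < c * \<beta>\<close>.  Negative association therefore gives
  \<open>P (h Y < c * \<beta>) * P (Y \<ge> b t) \<le> P (D t \<inter> {Y \<ge> b t})\<close>; summing over \<open>t\<close>, the right-hand side
  becomes the expected number of \<open>t\<close> for which both events occur.

  That number is at most \<open>2 ^ m * K\<close> for every outcome
  (\<open>card_dominated_with_small_complement_le\<close>).  Fix one such \<open>t\<close> and sort all such \<open>s\<close> by the trace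
  \<open>A s \<inter> A t\<close>, which takes at most \<open>2 ^ m\<close> values.  Two indices \<open>s\<close>, \<open>r\<close> with the same trace differ
  only off \<open>A t\<close>, that is, \<open>A s - A r\<close> is disjoint from \<open>A t\<close>, so the separation hypothesis still
  applies to \<open>Y\<close> with \<open>A t\<close> removed.  Hence a class of at least \<open>exp (2 * m)\<close> indices would by
  Bernoulli minoration with exponent \<open>2 * m\<close> force \<open>h \<ge> c * \<beta>\<close> off \<open>A t\<close>, contradicting \<open>D t\<close>.
\<close>

section \<open>Moments of sign sums\<close>

lemma set_pmf_sign_pmf: "set_pmf (sign_pmf d) = PiE_dflt {1..d} 0 (\<lambda>_. {-1, 1})"
  by (simp add: sign_pmf_def set_Pi_pmf comp_def)

lemma finite_set_pmf_sign_pmf [simp]: "finite (set_pmf (sign_pmf d))"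
  by (auto simp: set_pmf_sign_pmf)

lemma integrable_sign_pmf [simp]: "integrable (measure_pmf (sign_pmf d)) (f :: _ \<Rightarrow> real)"
  by (simp add: integrable_measure_pmf_finite)

lemma pmf_sign_pmf:
  assumes "e \<in> set_pmf (sign_pmf d)"
  shows "pmf (sign_pmf d) e = (1 / 2) ^ d"
proof -
  have e: "e i \<in> {-1, 1}" if "i \<in> {1..d}" for i
    using assms that by (auto simp: set_pmf_sign_pmf PiE_dflt_def)
  have e0: "e i = 0" if "i \<notin> {1..d}" for i
    using assms that by (auto simp: set_pmf_sign_pmf PiE_dflt_def)
  have "pmf (sign_pmf d) e = (\<Prod>i\<in>{1..d}. pmf (pmf_of_set {-1, 1}) (e i))"
    unfolding sign_pmf_def by (rule pmf_Pi') (use e0 in auto)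
  also have "\<dots> = (\<Prod>i\<in>{1..d}. 1 / 2)"
    by (intro prod.cong refl) (use e in \<open>auto simp: pmf_of_set\<close>)
  finally show ?thesis by simp
qed

lemma expectation_sign_pmf:
  fixes f :: "(nat \<Rightarrow> real) \<Rightarrow> real"
  shows "measure_pmf.expectation (sign_pmf d) f = (\<Sum>e\<in>set_pmf (sign_pmf d). f e) / 2 ^ d"
proof -
  have "measure_pmf.expectation (sign_pmf d) f
      = (\<Sum>e\<in>set_pmf (sign_pmf d). f e * pmf (sign_pmf d) e)"
    by (rule integral_measure_pmf_real) auto
  then show ?thesis
    by (simp add: pmf_sign_pmf sum_divide_distrib field_simps power_divide)
qed

lemma expectation_sign_pmf_flip:
  fixes f :: "(nat \<Rightarrow> real) \<Rightarrow> real"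
  assumes "i \<in> {1..d}"
  shows "measure_pmf.expectation (sign_pmf d) (\<lambda>e. f (e(i := - e i))) =
    measure_pmf.expectation (sign_pmf d) f"
proof -
  have "(\<Sum>e\<in>set_pmf (sign_pmf d). f (e(i := - e i))) = (\<Sum>e\<in>set_pmf (sign_pmf d). f e)"
    by (rule sum.reindex_bij_witness[where i = "\<lambda>e. e(i := - e i)" and j = "\<lambda>e. e(i := - e i)"])
       (use assms in \<open>auto simp: set_pmf_sign_pmf PiE_dflt_def\<close>)
  then show ?thesis by (simp add: expectation_sign_pmf)
qed

text \<open>
  With probability at least \<open>2 ^ (- n)\<close> all signs on the support agree with those of \<open>u\<close>, and then
  the sum equals the \<open>\<ell>\<^sub>1\<close> norm of \<open>u\<close>.  Taking the moment of order \<open>n\<close> turns this probability into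
  the factor \<open>1 / 2\<close>.
\<close>
lemma sign_norm_ge_half_sum:
  assumes D: "D \<subseteq> {1..d}" "card D \<le> n" and n: "n \<ge> 1"
    and u: "\<And>i. i \<in> {1..d} - D \<Longrightarrow> u i = 0"
  shows "sign_norm d (real n) u \<ge> (\<Sum>i=1..d. \<bar>u i\<bar>) / 2"
proof -
  define S where "S = (\<Sum>i=1..d. \<bar>u i\<bar>)"
  define E where "E = Pi {1..d} (\<lambda>i. if i \<in> D then {if u i \<ge> 0 then 1 else -1 :: real} else UNIV)"
  have S0: "S \<ge> 0" by (auto simp: S_def intro: sum_nonneg)
  have finD: "finite D" using D by (meson finite_atLeastAtMost finite_subset)
  have "measure_pmf.prob (sign_pmf d) E =
    (\<Prod>i\<in>{1..d}. measure_pmf.prob (pmf_of_set {-1, 1 :: real})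
        (if i \<in> D then {if u i \<ge> 0 then 1 else -1 :: real} else UNIV))"
    unfolding E_def sign_pmf_def by (rule measure_Pi_pmf_Pi) simp
  also have "\<dots> = (\<Prod>i\<in>{1..d}. if i \<in> D then 1 / 2 else 1)"
    by (intro prod.cong refl) (auto simp: measure_pmf_of_set)
  also have "\<dots> = (1 / 2) ^ card D"
    using D(1) by (simp add: prod.If_cases Int_absorb1)
  also have "\<dots> \<ge> (1 / 2) ^ n"
    using D(2) by (intro power_decreasing) auto
  finally have prob_E: "measure_pmf.prob (sign_pmf d) E \<ge> (1 / 2) ^ n" .
  have on_E: "(\<Sum>i=1..d. u i * e i) = S" if "e \<in> E" for e
    unfolding S_def
  proof (rule sum.cong)
    fix i assume i: "i \<in> {1..d}"
    show "u i * e i = \<bar>u i\<bar>"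
      using that i u[of i] by (cases "i \<in> D") (auto simp: E_def Pi_iff split: if_splits)
  qed simp
  have "(S / 2) powr real n = S ^ n * (1 / 2) ^ n"
    using S0 n by (simp add: powr_realpow' power_divide)
  also have "\<dots> \<le> S ^ n * measure_pmf.prob (sign_pmf d) E"
    using prob_E S0 by (intro mult_left_mono) auto
  also have "\<dots> = measure_pmf.expectation (sign_pmf d) (\<lambda>e. S ^ n * indicator E e)"
    by simp
  also have "\<dots> \<le> measure_pmf.expectation (sign_pmf d) (\<lambda>e. \<bar>\<Sum>i=1..d. u i * e i\<bar> powr real n)"
    using on_E S0 n by (intro integral_mono) (auto simp: indicator_def powr_realpow')
  finally have "((S / 2) powr real n) powr (1 / real n) \<le> sign_norm d (real n) u"
    unfolding sign_norm_def by (intro powr_mono2) auto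
  moreover have "((S / 2) powr real n) powr (1 / real n) = S / 2"
    using S0 n by (simp add: powr_powr)
  ultimately show ?thesis by (simp add: S_def)
qed

section \<open>Monotonicity of the mean maximum of sign sums\<close>

definition sign_max :: "'t set \<Rightarrow> ('t \<Rightarrow> nat set) \<Rightarrow> (nat \<Rightarrow> real) \<Rightarrow> (nat \<Rightarrow> real) \<Rightarrow> real" where
  "sign_max T A e y = (MAX t\<in>T. \<bar>\<Sum>i\<in>A t. e i * y i\<bar>)"

definition mean_sign_max :: "nat \<Rightarrow> 't set \<Rightarrow> ('t \<Rightarrow> nat set) \<Rightarrow> (nat \<Rightarrow> real) \<Rightarrow> real" where
  "mean_sign_max d T A y = measure_pmf.expectation (sign_pmf d) (\<lambda>e. sign_max T A e y)"

lemma sign_max_cong: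
  assumes "\<And>t. t \<in> T \<Longrightarrow> A t \<subseteq> I" "\<And>i. i \<in> I \<Longrightarrow> e i = e' i" "\<And>i. i \<in> I \<Longrightarrow> y i = y' i"
  shows "sign_max T A e y = sign_max T A e' y'"
  unfolding sign_max_def using assms
  by (intro arg_cong[where f = Max] image_cong refl arg_cong[where f = abs] sum.cong)
     (metis subsetD)

lemma mean_sign_max_cong:
  assumes "\<And>t. t \<in> T \<Longrightarrow> A t \<subseteq> {1..d}" "\<And>i. i \<in> {1..d} \<Longrightarrow> y i = y' i"
  shows "mean_sign_max d T A y = mean_sign_max d T A y'"
  unfolding mean_sign_max_def
  by (intro Bochner_Integration.integral_cong refl sign_max_cong[where I = "{1..d}"]) (use assms in auto)

lemma sign_max_nonneg:
  assumes "finite T" "T \<noteq> {}"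
  shows "sign_max T A e y \<ge> 0"
proof -
  obtain t where "t \<in> T" using assms by auto
  then have "\<bar>\<Sum>i\<in>A t. e i * y i\<bar> \<le> sign_max T A e y"
    unfolding sign_max_def using assms by (intro Max_ge) auto
  then show ?thesis by linarith
qed

text \<open>
  The mean of a convex function that is invariant under flipping the sign of \<open>y i\<close> increases with
  \<open>\<bar>y i\<bar>\<close>: any value \<open>a\<close> in between is a convex combination of \<open>y i\<close> and \<open>- y i\<close>, and flipping the
  sign of \<open>y i\<close> amounts to flipping \<open>e i\<close>.
\<close>
lemma mean_sign_max_shrink_coordinate:
  assumes T: "finite T" "T \<noteq> {}" and i: "i \<in> {1..d}" and a: "0 \<le> a" "a \<le> y i"
  shows "mean_sign_max d T A (y(i := a)) \<le> mean_sign_max d T A y"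
proof (cases "a = y i")
  case False
  then have yi: "y i > 0" using a by simp
  \<comment> \<open>The weight for which \<open>a = l * y i + (1 - l) * (- y i)\<close>.\<close>
  define l where "l = (1 + a / y i) / 2"
  have l: "0 \<le> l" "l \<le> 1" using a yi by (auto simp: l_def field_simps)
  have a_eq: "a = l * y i + (1 - l) * (- y i)"
    using yi by (simp add: l_def field_simps)
  define flip where "flip e = e(i := - e i)" for e :: "nat \<Rightarrow> real"
  have step: "sign_max T A e (y(i := a)) \<le> l * sign_max T A e y + (1 - l) * sign_max T A (flip e) y"
    for e
  proof -
    have "\<bar>\<Sum>j\<in>A t. e j * (y(i := a)) j\<bar>
        \<le> l * sign_max T A e y + (1 - l) * sign_max T A (flip e) y" if t: "t \<in> T" for t
    proof -
      have "(\<Sum>j\<in>A t. e j * (y(i := a)) j)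
          = (\<Sum>j\<in>A t. l * (e j * y j) + (1 - l) * (flip e j * y j))"
        by (intro sum.cong refl) (auto simp: flip_def a_eq algebra_simps)
      also have "\<dots> = l * (\<Sum>j\<in>A t. e j * y j) + (1 - l) * (\<Sum>j\<in>A t. flip e j * y j)"
        by (simp add: sum.distrib sum_distrib_left)
      also have "\<bar>\<dots>\<bar> \<le> l * \<bar>\<Sum>j\<in>A t. e j * y j\<bar> + (1 - l) * \<bar>\<Sum>j\<in>A t. flip e j * y j\<bar>"
        using l by (intro order_trans[OF abs_triangle_ineq]) (simp add: abs_mult)
      also have "\<dots> \<le> l * sign_max T A e y + (1 - l) * sign_max T A (flip e) y"
        unfolding sign_max_def using l T t
        by (intro add_mono mult_left_mono Max_ge) auto
      finally show ?thesis .
    qed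
    then show ?thesis
      unfolding sign_max_def[of T A e "y(i := a)"] using T by (intro Max.boundedI) auto
  qed
  have "mean_sign_max d T A (y(i := a)) \<le>
      measure_pmf.expectation (sign_pmf d)
        (\<lambda>e. l * sign_max T A e y + (1 - l) * sign_max T A (flip e) y)"
    unfolding mean_sign_max_def by (intro integral_mono step) auto
  also have "\<dots> = l * mean_sign_max d T A y + (1 - l) * mean_sign_max d T A y"
    unfolding mean_sign_max_def flip_def
    using expectation_sign_pmf_flip[OF i, of "\<lambda>e. sign_max T A e y"] by simp
  finally show ?thesis by (simp add: algebra_simps)
qed simp

text \<open>
  The contraction principle, by replacing \<open>y i\<close> with \<open>x i\<close> one coordinate at a time.
\<close>
lemma mean_sign_max_mono:
  assumes T: "finite T" "T \<noteq> {}" and A: "\<And>t. t \<in> T \<Longrightarrow> A t \<subseteq> {1..d}"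
    and x0: "\<And>i. i \<in> {1..d} \<Longrightarrow> 0 \<le> x i" and xy: "\<And>i. i \<in> {1..d} \<Longrightarrow> x i \<le> y i"
  shows "mean_sign_max d T A x \<le> mean_sign_max d T A y"
proof -
  have "mean_sign_max d T A (\<lambda>i. if i \<in> I then x i else y i) \<le> mean_sign_max d T A y"
    if "I \<subseteq> {1..d}" for I
  proof -
    have "finite I" using that by (meson finite_atLeastAtMost finite_subset)
    then show ?thesis using that
    proof induction
      case empty
      show ?case by simp
    next
      case (insert j I)
      let ?z = "\<lambda>i. if i \<in> I then x i else y i"
      have eq: "(\<lambda>i. if i \<in> insert j I then x i else y i) = ?z(j := x j)"
        by auto
      have "mean_sign_max d T A (?z(j := x j)) \<le> mean_sign_max d T A ?z"
        using insert.prems insert.hyps x0 xy T by (intro mean_sign_max_shrink_coordinate) auto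
      then show ?case using insert unfolding eq by auto
    qed
  qed
  note this[of "{1..d}"]
  moreover have "mean_sign_max d T A (\<lambda>i. if i \<in> {1..d} then x i else y i) = mean_sign_max d T A x"
    by (rule mean_sign_max_cong) (use A in auto)
  ultimately show ?thesis by simp
qed

section \<open>Separated families and minoration\<close>

text \<open>
  Minoration with exponent \<open>2 * m\<close>, applied to the restrictions of \<open>z\<close> to the sets \<open>A s\<close>.  The
  difference of two of them lives on at most \<open>2 * m\<close> coordinates and has \<open>\<ell>\<^sub>1\<close> norm at least
  \<open>2 * \<beta>\<close>, as both \<open>A s - A r\<close> and \<open>A r - A s\<close> contribute \<open>\<beta>\<close>; the factor \<open>1 / 2\<close> in
  \<open>sign_norm_ge_half_sum\<close> is thereby compensated exactly.
\<close>
lemma mean_sign_max_ge_of_separated: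
  assumes c: "bernoulli_sudakov_constant c"
    and T: "finite T" and A: "\<And>t. t \<in> T \<Longrightarrow> A t \<subseteq> {1..d}" "\<And>t. t \<in> T \<Longrightarrow> card (A t) \<le> m"
    and m: "m \<ge> 1" and F: "F \<subseteq> T" "real (card F) \<ge> exp (2 * real m)"
    and z: "\<And>i. i \<in> {1..d} \<Longrightarrow> 0 \<le> z i"
    and \<beta>: "\<beta> > 0"
    and sep: "\<And>s r. s \<in> F \<Longrightarrow> r \<in> F \<Longrightarrow> s \<noteq> r \<Longrightarrow> (\<Sum>i\<in>A s - A r. z i) \<ge> \<beta>"
  shows "mean_sign_max d T A z \<ge> c * \<beta>"
proof -
  define v where "v s = (\<lambda>i\<in>{1..d}. if i \<in> A s then z i else 0)" for s
  have finF: "finite F" using F T finite_subset by auto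
  have F_ne: "F \<noteq> {}" using F(2) by (auto simp: not_le)
  have finA: "finite (A s)" if "s \<in> F" for s
    using A(1)[of s] F that by (meson finite_atLeastAtMost finite_subset subsetD)
  have A_F: "A s \<subseteq> {1..d}" if "s \<in> F" for s
    using A(1) F that by auto
  have l1: "(\<Sum>i=1..d. \<bar>v s i - v r i\<bar>) \<ge> 2 * \<beta>" if "s \<in> F" "r \<in> F" "s \<noteq> r" for s r
  proof -
    have "(\<Sum>i=1..d. \<bar>v s i - v r i\<bar>) \<ge> (\<Sum>i\<in>(A s - A r) \<union> (A r - A s). \<bar>v s i - v r i\<bar>)"
      using A(1) F that by (intro sum_mono2) auto
    also have "(\<Sum>i\<in>(A s - A r) \<union> (A r - A s). \<bar>v s i - v r i\<bar>)
        = (\<Sum>i\<in>A s - A r. \<bar>v s i - v r i\<bar>) + (\<Sum>i\<in>A r - A s. \<bar>v s i - v r i\<bar>)"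
      using finA that by (intro sum.union_disjoint) auto
    also have "(\<Sum>i\<in>A s - A r. \<bar>v s i - v r i\<bar>) = (\<Sum>i\<in>A s - A r. z i)"
      using A_F[OF \<open>s \<in> F\<close>] z by (intro sum.cong) (auto simp: v_def)
    also have "(\<Sum>i\<in>A r - A s. \<bar>v s i - v r i\<bar>) = (\<Sum>i\<in>A r - A s. z i)"
      using A_F[OF \<open>r \<in> F\<close>] z by (intro sum.cong) (auto simp: v_def)
    finally show ?thesis using sep[of s r] sep[of r s] that by simp
  qed
  have inj: "inj_on v F"
  proof (rule inj_onI, rule ccontr)
    fix s r assume "s \<in> F" "r \<in> F" "v s = v r" "s \<noteq> r"
    then show False using l1[of s r] \<beta> by simp
  qed
  have norm: "sign_norm d (2 * real m) (\<lambda>i. v s i - v r i) \<ge> \<beta>"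
    if "s \<in> F" "r \<in> F" "s \<noteq> r" for s r
  proof -
    have "card (A s \<union> A r) \<le> 2 * m"
      using card_Un_le[of "A s" "A r"] A(2)[of s] A(2)[of r] F that by force
    then have "sign_norm d (real (2 * m)) (\<lambda>i. v s i - v r i) \<ge> (\<Sum>i=1..d. \<bar>v s i - v r i\<bar>) / 2"
      using A(1) F that m by (intro sign_norm_ge_half_sum[where D = "A s \<union> A r"]) (auto simp: v_def)
    then show ?thesis using l1[OF that] by simp
  qed
  have "c * \<beta> \<le> measure_pmf.expectation (sign_pmf d) (\<lambda>e. MAX w\<in>v ` F. \<bar>\<Sum>i=1..d. w i * e i\<bar>)"
  proof -
    have "2 * real m \<ge> 1" "v ` F \<subseteq> {1..d} \<rightarrow>\<^sub>E UNIV" "real (card (v ` F)) \<ge> exp (2 * real m)"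
      using m F inj by (simp_all add: card_image, auto simp: v_def)
    moreover have "\<forall>x\<in>v ` F. \<forall>w\<in>v ` F. x \<noteq> w \<longrightarrow> sign_norm d (2 * real m) (\<lambda>i. x i - w i) \<ge> \<beta>"
      using norm by auto
    ultimately show ?thesis
      using c \<beta> finF unfolding bernoulli_sudakov_constant_def by (meson finite_imageI)
  qed
  also have "\<dots> \<le> mean_sign_max d T A z"
    unfolding mean_sign_max_def
  proof (rule integral_mono)
    fix e :: "nat \<Rightarrow> real"
    have "(\<Sum>i=1..d. v s i * e i) = (\<Sum>i\<in>A s. e i * z i)" if "s \<in> F" for s
    proof -
      have "(\<Sum>i=1..d. v s i * e i) = (\<Sum>i=1..d. if i \<in> A s then e i * z i else 0)"
        by (intro sum.cong) (auto simp: v_def)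
      also have "\<dots> = (\<Sum>i\<in>{1..d} \<inter> A s. e i * z i)"
        by (simp add: sum.inter_restrict)
      also have "{1..d} \<inter> A s = A s" using A(1) F that by auto
      finally show ?thesis .
    qed
    then have "(MAX w\<in>v ` F. \<bar>\<Sum>i=1..d. w i * e i\<bar>) = (MAX s\<in>F. \<bar>\<Sum>i\<in>A s. e i * z i\<bar>)"
      by (simp add: image_image)
    also have "\<dots> \<le> sign_max T A e z"
      unfolding sign_max_def using F(1) F_ne T by (intro Max_mono image_mono) auto
    finally show "(MAX w\<in>v ` F. \<bar>\<Sum>i=1..d. w i * e i\<bar>) \<le> sign_max T A e z" .
  qed auto
  finally show ?thesis .
qed

text \<open>
  The combinatorial core.  If \<open>s\<close> and \<open>r\<close> have the same intersection with \<open>A t\<close>, then deleting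
  \<open>A t\<close> removes nothing from \<open>A s - A r\<close>, so a large class of such indices would remain separated
  off \<open>A t\<close>.  The pigeonhole principle over the subsets of \<open>A t\<close> costs the factor \<open>2 ^ m\<close>.
\<close>
lemma card_dominated_with_small_complement_le:
  assumes c: "bernoulli_sudakov_constant c"
    and T: "finite T" and A: "\<And>t. t \<in> T \<Longrightarrow> A t \<subseteq> {1..d}" "\<And>t. t \<in> T \<Longrightarrow> card (A t) \<le> m"
    and m: "m \<ge> 1"
    and y: "\<And>i. i \<in> {1..d} \<Longrightarrow> 0 \<le> y i"
    and \<beta>: "\<beta> > 0"
    and sep: "\<And>t s. t \<in> T \<Longrightarrow> s \<in> T \<Longrightarrow> t \<noteq> s \<Longrightarrow> (\<Sum>i\<in>A t - A s. b t i) \<ge> \<beta>"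
  shows "real (card {t \<in> T. (\<forall>i\<in>A t. b t i \<le> y i) \<and>
      mean_sign_max d T A (\<lambda>i. if i \<in> A t then 0 else y i) < c * \<beta>})
    \<le> 2 ^ m * real_of_int \<lceil>exp (2 * real m)\<rceil>"
    (is "real (card ?G) \<le> _")
proof (cases "?G = {}")
  case True
  show ?thesis unfolding True by (simp add: zero_le_ceiling less_le_trans[of "-1" 0])
next
  case False
  then obtain t where t: "t \<in> ?G" by blast
  have finG: "finite ?G" using T by simp
  have finA: "finite (A s)" if "s \<in> T" for s
    using A(1)[OF that] by (meson finite_atLeastAtMost finite_subset)
  define C where "C B = {s \<in> ?G. A s \<inter> A t = B}" for B
  have class_small: "real (card (C B)) \<le> real_of_int \<lceil>exp (2 * real m)\<rceil>" for B
  proof (rule ccontr)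
    assume "\<not> ?thesis"
    then have big: "real (card (C B)) \<ge> exp (2 * real m)" by linarith
    let ?z = "\<lambda>i. if i \<in> A t then 0 else y i"
    have "(\<Sum>i\<in>A s - A r. ?z i) \<ge> \<beta>" if "s \<in> C B" "r \<in> C B" "s \<noteq> r" for s r
    proof -
      have sG: "s \<in> ?G" "r \<in> ?G" and same: "A s \<inter> A t = A r \<inter> A t"
        using that by (auto simp: C_def)
      have "\<beta> \<le> (\<Sum>i\<in>A s - A r. b s i)" using sG that by (intro sep) auto
      also have "\<dots> \<le> (\<Sum>i\<in>A s - A r. ?z i)"
        by (intro sum_mono) (use sG same in auto)
      finally show ?thesis .
    qed
    then have "mean_sign_max d T A ?z \<ge> c * \<beta>"
      using big y by (intro mean_sign_max_ge_of_separated[OF c T A m _ _ _ \<beta>, where F = "C B"])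
        (auto simp: C_def)
    then show False using t by auto
  qed
  have cover: "?G = (\<Union>B\<in>Pow (A t). C B)" by (auto simp: C_def)
  have "finite (Pow (A t))" using finA[of t] t by simp
  then have "card ?G \<le> (\<Sum>B\<in>Pow (A t). card (C B))"
    unfolding cover by (rule card_UN_le)
  then have "real (card ?G) \<le> real (\<Sum>B\<in>Pow (A t). card (C B))"
    by (rule of_nat_mono)
  also have "\<dots> = (\<Sum>B\<in>Pow (A t). real (card (C B)))"
    by (rule of_nat_sum)
  also have "\<dots> \<le> real (card (Pow (A t))) * real_of_int \<lceil>exp (2 * real m)\<rceil>"
    by (rule sum_bounded_above) (rule class_small)
  also have "\<dots> \<le> 2 ^ m * real_of_int \<lceil>exp (2 * real m)\<rceil>"
  proof (rule mult_right_mono)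
    have "card (Pow (A t)) \<le> 2 ^ m"
      using A(2)[of t] finA[of t] t by (simp add: card_Pow)
    then have "real (card (Pow (A t))) \<le> real (2 ^ m)"
      by (rule of_nat_mono)
    then show "real (card (Pow (A t))) \<le> 2 ^ m" by simp
    show "real_of_int \<lceil>exp (2 * real m)\<rceil> \<ge> 0"
      using order_trans[OF exp_ge_zero le_of_int_ceiling] .
  qed
  finally show ?thesis .
qed

section \<open>Integrating out the signs\<close>

lemma measurable_sign_max:
  assumes T: "finite T" and A: "\<And>t. t \<in> T \<Longrightarrow> A t \<subseteq> I"
    and e: "\<And>i. i \<in> I \<Longrightarrow> (\<lambda>x. e x i) \<in> borel_measurable N"
    and y: "\<And>i. i \<in> I \<Longrightarrow> (\<lambda>x. y x i) \<in> borel_measurable N"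
  shows "(\<lambda>x. sign_max T A (e x) (y x)) \<in> borel_measurable N"
  unfolding sign_max_def using assms
  by (intro borel_measurable_Max borel_measurable_abs borel_measurable_sum borel_measurable_times) auto

lemma measurable_mean_sign_max:
  assumes T: "finite T" and A: "\<And>t. t \<in> T \<Longrightarrow> A t \<subseteq> {1..d}"
    and y: "\<And>i. i \<in> {1..d} \<Longrightarrow> (\<lambda>x. y x i) \<in> borel_measurable N"
  shows "(\<lambda>x. mean_sign_max d T A (y x)) \<in> borel_measurable N"
  unfolding mean_sign_max_def expectation_sign_pmf
  by (intro borel_measurable_divide borel_measurable_sum borel_measurable_const
        measurable_sign_max[OF T A]) (use y in auto)

text \<open>
  Each of the \<open>2 ^ d\<close> sign patterns is attained by \<open>\<epsilon>\<close> with probability \<open>(1 / 2) ^ d\<close>.  The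
  result is an inequality because \<open>f\<close> is not assumed to be measurable.
\<close>
lemma nn_integral_random_signs_ge:
  fixes f :: "(nat \<Rightarrow> real) \<Rightarrow> real"
  assumes P: "prob_space P" and signs: "random_signs P {1..d} \<epsilon>"
    and f0: "\<And>e. f e \<ge> 0"
    and f_cong: "\<And>e e'. (\<And>i. i \<in> {1..d} \<Longrightarrow> e i = e' i) \<Longrightarrow> f e = f e'"
  shows "ennreal (measure_pmf.expectation (sign_pmf d) f) \<le> (\<integral>\<^sup>+\<omega>. ennreal (f (\<lambda>i. \<epsilon> i \<omega>)) \<partial>P)"
proof -
  interpret prob_space P by fact
  have indep: "indep_vars (\<lambda>_. borel) \<epsilon> {1..d}"
    using signs by (simp add: random_signs_def)
  have meas [measurable]: "\<epsilon> i \<in> borel_measurable P" if "i \<in> {1..d}" for i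
    using indep that by (auto simp: indep_vars_def)
  define S where "S e = {\<omega> \<in> space P. \<forall>i\<in>{1..d}. \<epsilon> i \<omega> = e i}" for e :: "nat \<Rightarrow> real"
  have S_meas [measurable]: "S e \<in> sets P" for e
    unfolding S_def by measurable
  have prob_S: "prob (S e) = (1 / 2) ^ d" if e: "e \<in> set_pmf (sign_pmf d)" for e
  proof (cases "d = 0")
    case True
    then show ?thesis by (simp add: S_def prob_space)
  next
    case False
    have "S e = (\<Inter>i\<in>{1..d}. \<epsilon> i -` {e i} \<inter> space P)"
      using False by (auto simp: S_def)
    also have "prob \<dots> = (\<Prod>i\<in>{1..d}. prob (\<epsilon> i -` {e i} \<inter> space P))"
      by (rule indep_varsD_finite[OF indep]) (use False in auto)
    also have "\<dots> = (\<Prod>i\<in>{1..d}. 1 / 2)"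
    proof (rule prod.cong)
      fix i assume i: "i \<in> {1..d}"
      then have "e i = -1 \<or> e i = 1"
        using e by (auto simp: set_pmf_sign_pmf PiE_dflt_def)
      moreover have "\<epsilon> i -` {e i} \<inter> space P = {\<omega> \<in> space P. \<epsilon> i \<omega> = e i}" by auto
      ultimately show "prob (\<epsilon> i -` {e i} \<inter> space P) = 1 / 2"
        using signs i by (auto simp: random_signs_def)
    qed simp
    finally show ?thesis by simp
  qed
  have "ennreal (measure_pmf.expectation (sign_pmf d) f)
      = (\<Sum>e\<in>set_pmf (sign_pmf d). ennreal (f e * (1 / 2) ^ d))"
    using f0 by (simp add: expectation_sign_pmf sum_divide_distrib sum_nonneg power_divide)
  also have "\<dots> = (\<Sum>e\<in>set_pmf (sign_pmf d). ennreal (f e) * emeasure P (S e))"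
    using f0 by (intro sum.cong refl) (simp add: emeasure_eq_measure prob_S ennreal_mult)
  also have "\<dots> = (\<integral>\<^sup>+\<omega>. (\<Sum>e\<in>set_pmf (sign_pmf d). ennreal (f e) * indicator (S e) \<omega>) \<partial>P)"
    by (subst nn_integral_sum) (auto simp: nn_integral_cmult_indicator)
  also have "\<dots> \<le> (\<integral>\<^sup>+\<omega>. ennreal (f (\<lambda>i. \<epsilon> i \<omega>)) \<partial>P)"
  proof (rule nn_integral_mono)
    fix \<omega> assume \<omega>: "\<omega> \<in> space P"
    show "(\<Sum>e\<in>set_pmf (sign_pmf d). ennreal (f e) * indicator (S e) \<omega>) \<le> ennreal (f (\<lambda>i. \<epsilon> i \<omega>))"
    proof (cases "\<exists>e0\<in>set_pmf (sign_pmf d). \<omega> \<in> S e0")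
      case True
      then obtain e0 where e0: "e0 \<in> set_pmf (sign_pmf d)" "\<omega> \<in> S e0" by blast
      have uniq: "e = e0" if "e \<in> set_pmf (sign_pmf d)" "\<omega> \<in> S e" for e
      proof
        fix i show "e i = e0 i"
          using that e0 by (cases "i \<in> {1..d}") (auto simp: set_pmf_sign_pmf PiE_dflt_def S_def)
      qed
      have "(\<Sum>e\<in>set_pmf (sign_pmf d). ennreal (f e) * indicator (S e) \<omega>)
          = (\<Sum>e\<in>set_pmf (sign_pmf d). if e = e0 then ennreal (f e0) else 0)"
      proof (rule sum.cong)
        fix e assume e: "e \<in> set_pmf (sign_pmf d)"
        show "ennreal (f e) * indicator (S e) \<omega> = (if e = e0 then ennreal (f e0) else 0)"
        proof (cases "e = e0")
          case False
          then have "\<omega> \<notin> S e" using uniq[OF e] by blast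
          then show ?thesis using False by simp
        qed (use e0 in simp)
      qed simp
      also have "\<dots> = ennreal (f e0)"
        using e0 by simp
      also have "f e0 = f (\<lambda>i. \<epsilon> i \<omega>)"
        using e0 by (intro f_cong) (auto simp: S_def)
      finally show ?thesis by simp
    next
      case False
      then show ?thesis by (simp add: indicator_def)
    qed
  qed
  finally show ?thesis .
qed

text \<open>
  Independence makes the joint law a product, so the signs can be integrated out for each fixed
  value of \<open>Y\<close>.
\<close>
lemma nn_integral_mean_sign_max_le:
  assumes P: "prob_space P" and signs: "random_signs P {1..d} \<epsilon>"
    and indep: "prob_space.indep_var P
          (\<Pi>\<^sub>M i\<in>{1..d}. borel) (\<lambda>\<omega>. \<lambda>i\<in>{1..d}. \<epsilon> i \<omega>)
          (\<Pi>\<^sub>M i\<in>{1..d}. borel) (\<lambda>\<omega>. \<lambda>i\<in>{1..d}. Y i \<omega>)"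
    and T: "finite T" "T \<noteq> {}" and A: "\<And>t. t \<in> T \<Longrightarrow> A t \<subseteq> {1..d}"
  shows "(\<integral>\<^sup>+\<omega>. ennreal (mean_sign_max d T A (\<lambda>i. Y i \<omega>)) \<partial>P)
    \<le> (\<integral>\<^sup>+\<omega>. ennreal (sign_max T A (\<lambda>i. \<epsilon> i \<omega>) (\<lambda>i. Y i \<omega>)) \<partial>P)"
proof -
  interpret prob_space P by fact
  define S where "S = (\<Pi>\<^sub>M i\<in>{1..d}. (borel :: real measure))"
  define X where "X \<omega> = (\<lambda>i\<in>{1..d}. \<epsilon> i \<omega>)" for \<omega>
  define Z where "Z \<omega> = (\<lambda>i\<in>{1..d}. Y i \<omega>)" for \<omega>
  have indep': "indep_var S X S Z"
    using indep unfolding S_def X_def[abs_def] Z_def[abs_def] .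
  then have [measurable]: "X \<in> measurable P S" "Z \<in> measurable P S"
    and joint: "distr P S X \<Otimes>\<^sub>M distr P S Z = distr P (S \<Otimes>\<^sub>M S) (\<lambda>\<omega>. (X \<omega>, Z \<omega>))"
    using indep_var_distribution_eq[of S X S Z] by auto
  interpret X: prob_space "distr P S X" by (rule prob_space_distr) simp
  interpret Z: prob_space "distr P S Z" by (rule prob_space_distr) simp
  interpret XZ: pair_sigma_finite "distr P S X" "distr P S Z" ..
  let ?G = "\<lambda>(e, y). ennreal (sign_max T A e y)"
  have comp: "(\<lambda>x. x i) \<in> borel_measurable S" if "i \<in> {1..d}" for i
    unfolding S_def by (rule measurable_component_singleton) fact
  have "(\<lambda>p. sign_max T A (fst p) (snd p)) \<in> borel_measurable (S \<Otimes>\<^sub>M S)"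
    by (rule measurable_sign_max[OF T(1) A])
       (auto intro: measurable_compose[OF measurable_fst comp] measurable_compose[OF measurable_snd comp])
  then have G [measurable]: "?G \<in> borel_measurable (S \<Otimes>\<^sub>M S)"
    by (simp add: split_beta')
  have "(\<integral>\<^sup>+\<omega>. ennreal (mean_sign_max d T A (\<lambda>i. Y i \<omega>)) \<partial>P)
      \<le> (\<integral>\<^sup>+\<omega>. (\<integral>\<^sup>+\<omega>'. ?G (X \<omega>', Z \<omega>) \<partial>P) \<partial>P)"
  proof (rule nn_integral_mono)
    fix \<omega>
    have "ennreal (mean_sign_max d T A (\<lambda>i. Y i \<omega>))
        \<le> (\<integral>\<^sup>+\<omega>'. ennreal (sign_max T A (\<lambda>i. \<epsilon> i \<omega>') (\<lambda>i. Y i \<omega>)) \<partial>P)"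
      unfolding mean_sign_max_def
      by (rule nn_integral_random_signs_ge[OF P signs])
         (auto intro!: sign_max_nonneg T sign_max_cong[OF A])
    also have "\<dots> = (\<integral>\<^sup>+\<omega>'. ?G (X \<omega>', Z \<omega>) \<partial>P)"
      by (auto intro!: nn_integral_cong arg_cong[where f = ennreal] sign_max_cong[OF A] simp: X_def Z_def)
    finally show "ennreal (mean_sign_max d T A (\<lambda>i. Y i \<omega>)) \<le> (\<integral>\<^sup>+\<omega>'. ?G (X \<omega>', Z \<omega>) \<partial>P)" .
  qed
  also have "\<dots> = (\<integral>\<^sup>+y. (\<integral>\<^sup>+e. ?G (e, y) \<partial>distr P S X) \<partial>distr P S Z)"
  proof -
    have "(\<integral>\<^sup>+\<omega>'. ?G (X \<omega>', y) \<partial>P) = (\<integral>\<^sup>+e. ?G (e, y) \<partial>distr P S X)" for y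
    proof (rule nn_integral_distr[symmetric])
      have "(\<lambda>e. sign_max T A e y) \<in> borel_measurable S"
        by (rule measurable_sign_max[OF T(1) A]) (auto intro: comp)
      then show "(\<lambda>e. ?G (e, y)) \<in> borel_measurable (distr P S X)" by simp
    qed simp
    moreover have "(\<lambda>y. \<integral>\<^sup>+e. ?G (e, y) \<partial>distr P S X) \<in> borel_measurable S"
      by (rule X.borel_measurable_nn_integral) (use G measurable_pair_swap_iff[of ?G S S] in \<open>simp add: split_beta'\<close>)
    ultimately show ?thesis
      by (simp add: nn_integral_distr)
  qed
  also have "\<dots> = (\<integral>\<^sup>+p. ?G p \<partial>(distr P S X \<Otimes>\<^sub>M distr P S Z))"
    by (rule XZ.nn_integral_snd) simp
  also have "\<dots> = (\<integral>\<^sup>+\<omega>. ?G (X \<omega>, Z \<omega>) \<partial>P)"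
    unfolding joint by (subst nn_integral_distr) auto
  also have "\<dots> = (\<integral>\<^sup>+\<omega>. ennreal (sign_max T A (\<lambda>i. \<epsilon> i \<omega>) (\<lambda>i. Y i \<omega>)) \<partial>P)"
    by (auto intro!: nn_integral_cong arg_cong[where f = ennreal] sign_max_cong[OF A] simp: X_def Z_def)
  finally show ?thesis .
qed

section \<open>Negative association\<close>

text \<open>
  Negative association of the indicators of \<open>U\<close> and \<open>W\<close> bounds the probability of both up-sets
  occurring from above; passing to the complement of \<open>W\<close> reverses the inequality.
\<close>
lemma neg_associated_upset_downset:
  assumes P: "prob_space P" and na: "neg_associated P d Y"
    and Y: "\<And>i. i \<in> {1..d} \<Longrightarrow> Y i \<in> borel_measurable P"
    and IJ: "I \<subseteq> {1..d}" "J \<subseteq> {1..d}" "I \<inter> J = {}"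
    and U: "U \<in> sets (\<Pi>\<^sub>M i\<in>I. borel)" and W: "W \<in> sets (\<Pi>\<^sub>M i\<in>J. borel)"
    and U_up: "\<And>x y. x \<in> U \<Longrightarrow> y \<in> I \<rightarrow>\<^sub>E UNIV \<Longrightarrow> (\<And>i. i \<in> I \<Longrightarrow> x i \<le> y i) \<Longrightarrow> y \<in> U"
    and W_up: "\<And>x y. x \<in> W \<Longrightarrow> y \<in> J \<rightarrow>\<^sub>E UNIV \<Longrightarrow> (\<And>i. i \<in> J \<Longrightarrow> x i \<le> y i) \<Longrightarrow> y \<in> W"
  shows "measure P {\<omega> \<in> space P. (\<lambda>i\<in>I. Y i \<omega>) \<in> U} * measure P {\<omega> \<in> space P. (\<lambda>i\<in>J. Y i \<omega>) \<notin> W}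
    \<le> measure P {\<omega> \<in> space P. (\<lambda>i\<in>I. Y i \<omega>) \<in> U \<and> (\<lambda>i\<in>J. Y i \<omega>) \<notin> W}"
proof -
  interpret prob_space P by fact
  let ?U = "{\<omega> \<in> space P. (\<lambda>i\<in>I. Y i \<omega>) \<in> U}" and ?W = "{\<omega> \<in> space P. (\<lambda>i\<in>J. Y i \<omega>) \<in> W}"
  have Y_meas: "(\<lambda>\<omega>. \<lambda>i\<in>K. Y i \<omega>) \<in> measurable P (\<Pi>\<^sub>M i\<in>K. borel)" if "K \<subseteq> {1..d}" for K
    using that Y by (intro measurable_restrict) auto
  have events: "?U \<in> events" "?W \<in> events"
    using measurable_sets[OF Y_meas[OF IJ(1)] U] measurable_sets[OF Y_meas[OF IJ(2)] W]
    by (simp_all add: vimage_def Collect_conj_eq Int_commute)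
  have "bounded_increasing I (indicator U)" "bounded_increasing J (indicator W)"
    using U_up W_up unfolding bounded_increasing_def
    by (auto intro!: exI[of _ 1] simp: indicator_def)
  then have "(\<integral>\<omega>. indicator U (\<lambda>i\<in>I. Y i \<omega>) * indicator W (\<lambda>i\<in>J. Y i \<omega>) \<partial>P)
      \<le> (\<integral>\<omega>. indicator U (\<lambda>i\<in>I. Y i \<omega>) \<partial>P) * ((\<integral>\<omega>. indicator W (\<lambda>i\<in>J. Y i \<omega>) \<partial>P) :: real)"
    using na[unfolded neg_associated_def, rule_format, of I J "indicator U" "indicator W"] IJ U W
    by simp
  moreover have "(\<integral>\<omega>. indicator U (\<lambda>i\<in>I. Y i \<omega>) * indicator W (\<lambda>i\<in>J. Y i \<omega>) \<partial>P)
      = (\<integral>\<omega>. indicator (?U \<inter> ?W) \<omega> \<partial>P :: real)"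
    by (intro Bochner_Integration.integral_cong) (auto simp: indicator_def)
  moreover have "(\<integral>\<omega>. indicator U (\<lambda>i\<in>I. Y i \<omega>) \<partial>P) = (\<integral>\<omega>. indicator ?U \<omega> \<partial>P :: real)"
    "(\<integral>\<omega>. indicator W (\<lambda>i\<in>J. Y i \<omega>) \<partial>P) = (\<integral>\<omega>. indicator ?W \<omega> \<partial>P :: real)"
    by (intro Bochner_Integration.integral_cong; auto simp: indicator_def)+
  ultimately have na': "prob (?U \<inter> ?W) \<le> prob ?U * prob ?W"
    using events by simp
  have "{\<omega> \<in> space P. (\<lambda>i\<in>J. Y i \<omega>) \<notin> W} = space P - ?W" by auto
  then have compl: "prob {\<omega> \<in> space P. (\<lambda>i\<in>J. Y i \<omega>) \<notin> W} = 1 - prob ?W"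
    using events by (simp add: prob_compl)
  have "{\<omega> \<in> space P. (\<lambda>i\<in>I. Y i \<omega>) \<in> U \<and> (\<lambda>i\<in>J. Y i \<omega>) \<notin> W} = ?U - ?U \<inter> ?W" by auto
  then have "prob {\<omega> \<in> space P. (\<lambda>i\<in>I. Y i \<omega>) \<in> U \<and> (\<lambda>i\<in>J. Y i \<omega>) \<notin> W}
      = prob ?U - prob (?U \<inter> ?W)"
    using events by (simp add: finite_measure_Diff)
  then show ?thesis
    unfolding compl using na' by (simp add: algebra_simps)
qed

text \<open>
  Each product of probabilities is bounded by the probability of an intersection, and the expected
  number of intersections that occur is bounded by counting.  The test functions for negative
  association must be monotone on the whole space, not only where the coordinates are nonnegative;
  this is why positive parts are taken.
\<close>
lemma prob_mean_sign_max_small_mult_le: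
  assumes P: "prob_space P" and c: "bernoulli_sudakov_constant c"
    and Y: "\<And>i. i \<in> {1..d} \<Longrightarrow> Y i \<in> borel_measurable P"
    and na: "neg_associated P d Y"
    and T: "finite T" "T \<noteq> {}" and m: "m \<ge> 1"
    and A: "\<And>t. t \<in> T \<Longrightarrow> A t \<subseteq> {1..d}" "\<And>t. t \<in> T \<Longrightarrow> card (A t) \<le> m"
    and \<beta>: "\<beta> > 0"
    and sep: "\<And>t s. t \<in> T \<Longrightarrow> s \<in> T \<Longrightarrow> t \<noteq> s \<Longrightarrow> (\<Sum>i\<in>A t - A s. b t i) \<ge> \<beta>"
  shows "measure P {\<omega> \<in> space P. mean_sign_max d T A (\<lambda>i. max 0 (Y i \<omega>)) < c * \<beta>}
      * (\<Sum>t\<in>T. measure P {\<omega> \<in> space P. \<forall>i\<in>A t. b t i \<le> Y i \<omega>})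
    \<le> 2 ^ m * real_of_int \<lceil>exp (2 * real m)\<rceil>"
proof -
  interpret prob_space P by fact
  note [measurable] = Y
  let ?h = "mean_sign_max d T A"
  let ?L = "2 ^ m * real_of_int \<lceil>exp (2 * real m)\<rceil>"
  define E where "E = {\<omega> \<in> space P. ?h (\<lambda>i. max 0 (Y i \<omega>)) < c * \<beta>}"
  define B where "B t = {\<omega> \<in> space P. \<forall>i\<in>A t. b t i \<le> Y i \<omega>}" for t
  define D where "D t = {\<omega> \<in> space P. ?h (\<lambda>i. if i \<in> A t then 0 else max 0 (Y i \<omega>)) < c * \<beta>}" for t
  have finA: "finite (A t)" if "t \<in> T" for t
    using A(1)[OF that] by (meson finite_atLeastAtMost finite_subset)
  have h_meas: "(\<lambda>\<omega>. ?h (\<lambda>i. if i \<in> A t then 0 else max 0 (Y i \<omega>))) \<in> borel_measurable P" for t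
    by (rule measurable_mean_sign_max[OF T(1) A(1)]) auto
  have D_events: "D t \<in> events" for t
    unfolding D_def using h_meas[of t] by measurable
  have B_events: "B t \<in> events" if t: "t \<in> T" for t
  proof -
    have "(\<lambda>\<omega>. Y i \<omega>) \<in> borel_measurable P" if "i \<in> A t" for i
      using A(1)[OF t] that Y by auto
    then show ?thesis
      unfolding B_def using finA[OF t] by measurable
  qed
  have BD: "integrable P (indicator (B t \<inter> D t) :: 'a \<Rightarrow> real)" if "t \<in> T" for t
    using B_events[OF that] D_events[of t]
    by (intro integrable_real_indicator) (auto simp: emeasure_eq_measure)
  have E_sub_D: "E \<subseteq> D t" for t
  proof
    fix \<omega> assume "\<omega> \<in> E"
    moreover have "?h (\<lambda>i. if i \<in> A t then 0 else max 0 (Y i \<omega>)) \<le> ?h (\<lambda>i. max 0 (Y i \<omega>))"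
      by (rule mean_sign_max_mono[OF T A(1)]) auto
    ultimately show "\<omega> \<in> D t" by (auto simp: E_def D_def)
  qed
  have assoc: "prob (B t) * prob (D t) \<le> prob (B t \<inter> D t)" if t: "t \<in> T" for t
  proof -
    let ?J = "{1..d} - A t"
    define U where "U = {x \<in> space (\<Pi>\<^sub>M i\<in>A t. (borel :: real measure)). \<forall>i\<in>A t. b t i \<le> x i}"
    define ext where "ext x = (\<lambda>i. if i \<in> ?J then max 0 (x i) else 0 :: real)" for x :: "nat \<Rightarrow> real"
    define W where "W = {x \<in> space (\<Pi>\<^sub>M i\<in>?J. (borel :: real measure)). c * \<beta> \<le> ?h (ext x)}"
    have U_meas: "U \<in> sets (\<Pi>\<^sub>M i\<in>A t. borel)"
      unfolding U_def using finA[OF t] by measurable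
    have ext_meas: "(\<lambda>x. ?h (ext x)) \<in> borel_measurable (\<Pi>\<^sub>M i\<in>?J. borel)"
    proof (rule measurable_mean_sign_max[OF T(1) A(1)])
      fix i
      show "(\<lambda>x. ext x i) \<in> borel_measurable (\<Pi>\<^sub>M i\<in>?J. borel)"
      proof (cases "i \<in> ?J")
        case True
        then have "(\<lambda>x :: nat \<Rightarrow> real. x i) \<in> borel_measurable (\<Pi>\<^sub>M i\<in>?J. borel)"
          by (rule measurable_component_singleton)
        then show ?thesis using True by (simp add: ext_def)
      next
        case False
        then have "(\<lambda>x. ext x i) = (\<lambda>_. 0)" by (auto simp: ext_def)
        then show ?thesis by simp
      qed
    qed
    have W_meas: "W \<in> sets (\<Pi>\<^sub>M i\<in>?J. borel)"
      unfolding W_def using ext_meas by measurable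
    have "prob {\<omega> \<in> space P. (\<lambda>i\<in>A t. Y i \<omega>) \<in> U} * prob {\<omega> \<in> space P. (\<lambda>i\<in>?J. Y i \<omega>) \<notin> W}
      \<le> prob {\<omega> \<in> space P. (\<lambda>i\<in>A t. Y i \<omega>) \<in> U \<and> (\<lambda>i\<in>?J. Y i \<omega>) \<notin> W}"
    proof (rule neg_associated_upset_downset[OF P na Y _ _ _ U_meas W_meas])
      fix x y :: "nat \<Rightarrow> real"
      assume x: "x \<in> U" and y: "y \<in> A t \<rightarrow>\<^sub>E UNIV" and xy: "\<And>i. i \<in> A t \<Longrightarrow> x i \<le> y i"
      show "y \<in> U"
        using x y order_trans[OF _ xy] by (auto simp: U_def space_PiM)
    next
      fix x y :: "nat \<Rightarrow> real"
      assume x: "x \<in> W" and y: "y \<in> ?J \<rightarrow>\<^sub>E UNIV" and xy: "\<And>i. i \<in> ?J \<Longrightarrow> x i \<le> y i"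
      have "?h (ext x) \<le> ?h (ext y)"
      proof (rule mean_sign_max_mono[OF T A(1)])
        fix i show "0 \<le> ext x i" "ext x i \<le> ext y i"
          using xy[of i] by (auto simp: ext_def)
      qed
      then show "y \<in> W" using x y by (auto simp: W_def space_PiM)
    qed (use A(1)[OF t] in auto)
    moreover have "?h (ext (\<lambda>i\<in>?J. Y i \<omega>)) = ?h (\<lambda>i. if i \<in> A t then 0 else max 0 (Y i \<omega>))" for \<omega>
      by (rule mean_sign_max_cong[OF A(1)]) (auto simp: ext_def)
    then have "{\<omega> \<in> space P. (\<lambda>i\<in>A t. Y i \<omega>) \<in> U} = B t"
      "{\<omega> \<in> space P. (\<lambda>i\<in>?J. Y i \<omega>) \<notin> W} = D t"
      "{\<omega> \<in> space P. (\<lambda>i\<in>A t. Y i \<omega>) \<in> U \<and> (\<lambda>i\<in>?J. Y i \<omega>) \<notin> W} = B t \<inter> D t"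
      by (auto simp: U_def W_def B_def D_def space_PiM)
    ultimately show ?thesis by simp
  qed
  have "prob E * (\<Sum>t\<in>T. prob (B t)) = (\<Sum>t\<in>T. prob (B t) * prob E)"
    by (simp add: sum_distrib_left mult.commute)
  also have "\<dots> \<le> (\<Sum>t\<in>T. prob (B t) * prob (D t))"
    using E_sub_D D_events by (intro sum_mono mult_left_mono finite_measure_mono) auto
  also have "\<dots> \<le> (\<Sum>t\<in>T. prob (B t \<inter> D t))"
    using assoc by (intro sum_mono) auto
  also have "\<dots> = expectation (\<lambda>\<omega>. \<Sum>t\<in>T. indicator (B t \<inter> D t) \<omega>)"
    using BD B_events D_events by (subst Bochner_Integration.integral_sum) (auto intro!: sum.cong)
  also have "\<dots> \<le> expectation (\<lambda>\<omega>. ?L)"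
  proof (rule integral_mono)
    show "integrable P (\<lambda>\<omega>. \<Sum>t\<in>T. indicator (B t \<inter> D t) \<omega> :: real)"
      using BD by (intro Bochner_Integration.integrable_sum) auto
    fix \<omega> assume \<omega>: "\<omega> \<in> space P"
    let ?y = "\<lambda>i. max 0 (Y i \<omega>)"
    have "(\<Sum>t\<in>T. indicator (B t \<inter> D t) \<omega>) = real (card {t \<in> T. \<omega> \<in> B t \<inter> D t})"
      using T(1) by (simp add: indicator_def sum.If_cases Int_def)
    also have "\<dots> \<le> real (card {t \<in> T. (\<forall>i\<in>A t. b t i \<le> ?y i) \<and>
        ?h (\<lambda>i. if i \<in> A t then 0 else ?y i) < c * \<beta>})"
      using T(1) by (intro of_nat_mono card_mono) (auto simp: B_def D_def max.coboundedI2)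
    also have "\<dots> \<le> ?L"
      by (rule card_dominated_with_small_complement_le[OF c T(1) A m _ \<beta> sep]) auto
    finally show "(\<Sum>t\<in>T. indicator (B t \<inter> D t) \<omega>) \<le> ?L" .
  qed simp
  finally show ?thesis
    by (simp add: E_def B_def prob_space)
qed

section \<open>The lower bound for the maximum\<close>

theorem lemma5p2:
  fixes c\<^sub>B \<beta> \<Lambda> :: real
    and P :: "'a measure"
    and d m :: nat
    and Y \<epsilon> :: "nat \<Rightarrow> 'a \<Rightarrow> real"
    and T :: "'t set"
    and A :: "'t \<Rightarrow> nat set"
    and b :: "'t \<Rightarrow> nat \<Rightarrow> real"
    and M :: ennreal
    and L :: real
  assumes c\<^sub>B: "bernoulli_sudakov_constant c\<^sub>B"
    and P: "prob_space P"
    and Y_measurable: "\<And>i. i \<in> {1..d} \<Longrightarrow> Y i \<in> borel_measurable P"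
    and Y_nonneg: "AE \<omega> in P. \<forall>i\<in>{1..d}. 0 \<le> Y i \<omega>"
    and Y_neg_assoc: "neg_associated P d Y"
    and signs: "random_signs P {1..d} \<epsilon>"
    and signs_indep_Y: "prob_space.indep_var P
          (\<Pi>\<^sub>M i\<in>{1..d}. borel) (\<lambda>\<omega>. \<lambda>i\<in>{1..d}. \<epsilon> i \<omega>)
          (\<Pi>\<^sub>M i\<in>{1..d}. borel) (\<lambda>\<omega>. \<lambda>i\<in>{1..d}. Y i \<omega>)"
    and T: "finite T" "card T \<ge> 2"
    and m: "m \<ge> 1"
    and A: "\<And>t. t \<in> T \<Longrightarrow> A t \<subseteq> {1..d}" "\<And>t. t \<in> T \<Longrightarrow> card (A t) \<le> m"
    and b_nonneg: "\<And>t i. t \<in> T \<Longrightarrow> i \<in> {1..d} \<Longrightarrow> 0 \<le> b t i"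
    and b_support: "\<And>t i. t \<in> T \<Longrightarrow> i \<in> {1..d} - A t \<Longrightarrow> b t i = 0"
    and \<beta>: "\<beta> > 0"
    and separation: "\<And>t s. t \<in> T \<Longrightarrow> s \<in> T \<Longrightarrow> t \<noteq> s \<Longrightarrow> (\<Sum>i\<in>A t - A s. b t i) \<ge> \<beta>"
    and \<Lambda>_eq: "\<Lambda> = (\<Sum>t\<in>T. measure P {\<omega> \<in> space P. \<forall>i\<in>{1..d}. b t i \<le> Y i \<omega>})"
    and \<Lambda>_pos: "\<Lambda> > 0"
    and M_eq: "M = (\<integral>\<^sup>+\<omega>. ennreal (MAX t\<in>T. \<bar>\<Sum>i\<in>A t. \<epsilon> i \<omega> * Y i \<omega>\<bar>) \<partial>P)"
    and L_eq: "L = 2 ^ m * real_of_int \<lceil>exp (2 * real m)\<rceil>"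
  shows "M \<ge> ennreal (c\<^sub>B * \<beta> * max (1 - L / \<Lambda>) 0)"
proof -
  interpret prob_space P by fact
  have T_ne: "T \<noteq> {}" using T by auto
  define h where "h \<omega> = mean_sign_max d T A (\<lambda>i. max 0 (Y i \<omega>))" for \<omega>
  have h_meas [measurable]: "h \<in> borel_measurable P"
    unfolding h_def using T(1) A(1) Y_measurable by (intro measurable_mean_sign_max) auto
  define E where "E = {\<omega> \<in> space P. h \<omega> < c\<^sub>B * \<beta>}"
  have E: "E \<in> events" unfolding E_def by measurable
  have c0: "c\<^sub>B > 0" using c\<^sub>B by (simp add: bernoulli_sudakov_constant_def)
  \<comment> \<open>The event for each \<open>t\<close> grows when only the coordinates in \<open>A t\<close> are constrained.\<close>
  have "\<Lambda> \<le> (\<Sum>t\<in>T. prob {\<omega> \<in> space P. \<forall>i\<in>A t. b t i \<le> Y i \<omega>})"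
    unfolding \<Lambda>_eq
  proof (intro sum_mono finite_measure_mono)
    fix t assume t: "t \<in> T"
    have "finite (A t)" using A(1)[OF t] by (meson finite_atLeastAtMost finite_subset)
    moreover have "(\<lambda>\<omega>. Y i \<omega>) \<in> borel_measurable P" if "i \<in> A t" for i
      using A(1)[OF t] that Y_measurable by auto
    ultimately show "{\<omega> \<in> space P. \<forall>i\<in>A t. b t i \<le> Y i \<omega>} \<in> events" by measurable
  qed (use A(1) in blast)
  then have "prob E * \<Lambda> \<le> prob E * (\<Sum>t\<in>T. prob {\<omega> \<in> space P. \<forall>i\<in>A t. b t i \<le> Y i \<omega>})"
    by (intro mult_left_mono) auto
  also have "\<dots> \<le> L"
    unfolding E_def h_def L_eq
    by (rule prob_mean_sign_max_small_mult_le[OF P c\<^sub>B _ Y_neg_assoc T(1) T_ne m _ _ \<beta>])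
       (use Y_measurable A separation in auto)
  finally have "prob E * \<Lambda> \<le> L" .
  then have "prob E \<le> L / \<Lambda>"
    using \<Lambda>_pos by (simp add: pos_le_divide_eq)
  then have "max (1 - L / \<Lambda>) 0 \<le> prob (space P - E)"
    using E by (simp add: prob_compl)
  then have "ennreal (c\<^sub>B * \<beta> * max (1 - L / \<Lambda>) 0) \<le> ennreal (c\<^sub>B * \<beta> * prob (space P - E))"
    using c0 \<beta> by (intro ennreal_leI mult_left_mono) auto
  also have "\<dots> = (\<integral>\<^sup>+\<omega>. ennreal (c\<^sub>B * \<beta>) * indicator (space P - E) \<omega> \<partial>P)"
    using c0 \<beta> E by (simp add: nn_integral_cmult_indicator emeasure_eq_measure ennreal_mult)
  also have "\<dots> \<le> (\<integral>\<^sup>+\<omega>. ennreal (h \<omega>) \<partial>P)"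
    by (intro nn_integral_mono) (auto simp: E_def indicator_def intro!: ennreal_leI)
  also have "\<dots> = (\<integral>\<^sup>+\<omega>. ennreal (mean_sign_max d T A (\<lambda>i. Y i \<omega>)) \<partial>P)"
  proof (rule nn_integral_cong_AE)
    show "AE \<omega> in P. ennreal (h \<omega>) = ennreal (mean_sign_max d T A (\<lambda>i. Y i \<omega>))"
      using Y_nonneg
    proof eventually_elim
      case (elim \<omega>)
      show ?case
        unfolding h_def by (intro arg_cong[where f = ennreal] mean_sign_max_cong A) (use elim in auto)
    qed
  qed
  also have "\<dots> \<le> (\<integral>\<^sup>+\<omega>. ennreal (sign_max T A (\<lambda>i. \<epsilon> i \<omega>) (\<lambda>i. Y i \<omega>)) \<partial>P)"
    by (rule nn_integral_mean_sign_max_le[OF P signs signs_indep_Y T(1) T_ne A(1)])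
  also have "\<dots> = M"
    unfolding M_eq sign_max_def ..
  finally show ?thesis .
qed

end
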